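(* Let $m,n$ be positive integers. Then $va^\equiv_1(K_{m,n})$ is given as follows, where $b$ and $c$ denote positive integers: (1) if $m=1$, then $va^\equiv_1(K_{1,n})=\lceil (n+2)/3\rceil$; (2) if $m=2$, then $va^\equiv_1(K_{2,n})=\lceil (n+3)/3\rceil$; (3) if $m=3b$ and $n=3c$, then $va^\equiv_1(K_{m,n})=p(b+c:m,n)$; (4) if $m=3b$ and $n=3c+1$, then $va^\equiv_1(K_{m,n})=p(b+c:m,n)$; (5) if $m=3b$ and $n=3c+2$, then $va^\equiv_1(K_{m,n})=p(b+c+1:m,n)$; (6) if $m=3b+1$ and $n=3c+1$, then $va^\equiv_1(K_{m,n})=p(b+c:m,n)$; (7) if $m=3b+1$ and $n=3c+2$, then $va^\equiv_1(K_{m,n})=b+c+2$; (8) if $m=3b+2$ and $n=3c+2$, then $va^\equiv_1(K_{m,n})=b+c+2$.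
   Context: All graphs are finite and simple. For a graph $G$ with $N=|V(G)|$ vertices, an equitable $q$-coloring of $G$ is a partition of $V(G)$ into $q$ (possibly empty) independent sets, each of size $\lfloor N/q\rfloor$ or $\lceil N/q\rceil$. An equitable $(q,r)$-tree-coloring of $G$ is a partition of $V(G)$ into $q$ sets (color classes), each of size $\lfloor N/q\rfloor$ or $\lceil N/q\rceil$, such that each set induces a forest of maximum degree at most $r$. The strong equitable vertex $r$-arboricity $va^\equiv_r(G)$ is the minimum $p$ such that $G$ has an equitable $(q,r)$-tree-coloring for every integer $q\ge p$. $K_{n_1,\ldots,n_k}$ is the complete $k$-partite graph with partite sets $X_1,\ldots,X_k$, $|X_i|=n_i$; $K_{m,n}$ is the complete bipartite graph with parts of sizes $m$ and $n$. Definition of $p$: suppose $K_{n_1,\ldots,n_k}$ has an equitable $q$-coloring. Then $p(q:n_1,\ldots,n_k)=\lceil n_1/d\rceil+\cdots+\lceil n_k/d\rceil$, where $d$ is the minimum integer with $d\ge\lceil (n_1+\cdots+n_k)/q\rceil$ satisfying at least one of: (i) there exist $i\ne j$ such that neither $n_i$ nor $n_j$ is divisible by $d$; (ii) there exists $i$ with $n_i/\lfloor n_i/d\rfloor>d+1$. *)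

theory Defs
  imports Complex_Main "HOL-Library.Disjoint_Sets"
begin

type_synonym 'a ugraph = "'a set \<times> 'a set set"

abbreviation verts :: "'a ugraph \<Rightarrow> 'a set" where "verts G \<equiv> fst G"
abbreviation edges :: "'a ugraph \<Rightarrow> 'a set set" where "edges G \<equiv> snd G"

definition simple_graph :: "'a ugraph \<Rightarrow> bool" where
  "simple_graph G \<longleftrightarrow> finite (verts G) \<and> (\<forall>e \<in> edges G. e \<subseteq> verts G \<and> card e = 2)"

definition induced :: "'a ugraph \<Rightarrow> 'a set \<Rightarrow> 'a ugraph" where
  "induced G S = (verts G \<inter> S, {e \<in> edges G. e \<subseteq> S})"

definition degree :: "'a ugraph \<Rightarrow> 'a \<Rightarrow> nat" where
  "degree G v = card {e \<in> edges G. v \<in> e}"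

text \<open>A cycle is given by its cyclic sequence of at least three distinct vertices.\<close>
definition is_cycle :: "'a ugraph \<Rightarrow> 'a list \<Rightarrow> bool" where
  "is_cycle G vs \<longleftrightarrow> length vs \<ge> 3 \<and> distinct vs \<and>
     (\<forall>i < length vs. {vs ! i, vs ! ((i + 1) mod length vs)} \<in> edges G)"

definition forest :: "'a ugraph \<Rightarrow> bool" where
  "forest G \<longleftrightarrow> \<not> (\<exists>vs. is_cycle G vs)"

definition independent :: "'a ugraph \<Rightarrow> 'a set \<Rightarrow> bool" where
  "independent G S \<longleftrightarrow> (\<forall>e \<in> edges G. \<not> e \<subseteq> S)"

text \<open>Partitions into \<open>q\<close> sets are indexed families, so that several classes may be empty.\<close>
definition equitable_partition :: "nat \<Rightarrow> 'a ugraph \<Rightarrow> (nat \<Rightarrow> 'a set) \<Rightarrow> bool" where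
  "equitable_partition q G A \<longleftrightarrow>
     (\<Union>i<q. A i) = verts G \<and> disjoint_family_on A {..<q} \<and>
     (\<forall>i<q. int (card (A i)) \<in> {\<lfloor>real (card (verts G)) / real q\<rfloor>, \<lceil>real (card (verts G)) / real q\<rceil>})"

definition has_equitable_coloring :: "nat \<Rightarrow> 'a ugraph \<Rightarrow> bool" where
  "has_equitable_coloring q G \<longleftrightarrow>
     (\<exists>A. equitable_partition q G A \<and> (\<forall>i<q. independent G (A i)))"

definition has_equitable_tree_coloring :: "nat \<Rightarrow> nat \<Rightarrow> 'a ugraph \<Rightarrow> bool" where
  "has_equitable_tree_coloring q r G \<longleftrightarrow>
     (\<exists>A. equitable_partition q G A \<and>
        (\<forall>i<q. forest (induced G (A i)) \<and>
               (\<forall>v \<in> verts (induced G (A i)). degree (induced G (A i)) v \<le> r)))"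

definition strong_equitable_arboricity :: "nat \<Rightarrow> 'a ugraph \<Rightarrow> nat" where
  "strong_equitable_arboricity r G = (LEAST p. \<forall>q\<ge>p. has_equitable_tree_coloring q r G)"

text \<open>The vertex \<open>(i, x)\<close> is the \<open>x\<close>-th vertex of the \<open>i\<close>-th partite set.\<close>
definition complete_multipartite :: "nat list \<Rightarrow> (nat \<times> nat) ugraph" where
  "complete_multipartite ns =
     (let V = {(i, x). i < length ns \<and> x < ns ! i}
      in (V, {{u, v} | u v. u \<in> V \<and> v \<in> V \<and> fst u \<noteq> fst v}))"

abbreviation complete_bipartite :: "nat \<Rightarrow> nat \<Rightarrow> (nat \<times> nat) ugraph" where
  "complete_bipartite m n \<equiv> complete_multipartite [m, n]"

lemma simple_graph_complete_multipartite: "simple_graph (complete_multipartite ns)"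
proof -
  have "{(i, x). i < length ns \<and> x < ns ! i} = (SIGMA i:{..<length ns}. {..<ns ! i})"
    by auto
  then have "finite {(i, x). i < length ns \<and> x < ns ! i}"
    by simp
  then show ?thesis
    by (auto simp: simple_graph_def complete_multipartite_def Let_def card_2_iff)
qed

text \<open>
  In the second alternative the quotient has denominator 0 when \<open>n\<^sub>i < d\<close>; it is then read
  as infinite, hence larger than \<open>d + 1\<close>. As \<open>x / 0 = 0\<close> in HOL, this case is a separate disjunct.
\<close>
definition p_cond :: "nat list \<Rightarrow> nat \<Rightarrow> bool" where
  "p_cond ns d \<longleftrightarrow>
     (\<exists>i j. i < length ns \<and> j < length ns \<and> i \<noteq> j \<and> \<not> d dvd ns ! i \<and> \<not> d dvd ns ! j) \<or>
     (\<exists>i < length ns. (0 < ns ! i \<and> ns ! i < d) \<or>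
        real (ns ! i) / real_of_int \<lfloor>real (ns ! i) / real d\<rfloor> > real d + 1)"

definition p_min :: "nat \<Rightarrow> nat list \<Rightarrow> nat" where
  "p_min q ns = (LEAST d. int d \<ge> \<lceil>real (sum_list ns) / real q\<rceil> \<and> p_cond ns d)"

text \<open>Only specified when the complete multipartite graph has an equitable \<open>q\<close>-coloring.\<close>
definition p_num :: "nat \<Rightarrow> nat list \<Rightarrow> nat" where
  "p_num q ns =
     (if has_equitable_coloring q (complete_multipartite ns)
      then (\<Sum>i<length ns. nat \<lceil>real (ns ! i) / real (p_min q ns)\<rceil>)
      else undefined)"

end

theory Submission
  imports Defs
begin

text \<open>
  A set with \<open>a\<close> vertices in one part of \<open>K\<^bsub>m,n\<^esub>\<close> and \<open>b\<close> in the other induces a forest of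
  maximum degree at most 1 iff \<open>a = 0\<close>, \<open>b = 0\<close> or \<open>a = b = 1\<close>. Put \<open>N = m + n\<close>. For \<open>3q \<le> N\<close> all
  classes have at least three vertices, so an equitable \<open>(q, 1)\<close>-tree-coloring is an equitable
  \<open>q\<close>-coloring. For \<open>2q < N < 3q\<close> one only has to place \<open>N - 2q\<close> independent triples, since pairs are
  unrestricted; this needs \<open>N - 2q \<le> \<lfloor>m/3\<rfloor> + \<lfloor>n/3\<rfloor>\<close>.

  Equitable colorings with classes of sizes \<open>d\<close>, \<open>d + 1\<close> exist for all \<open>q\<close> between
  \<open>\<lceil>m/(d+1)\<rceil> + \<lceil>n/(d+1)\<rceil>\<close> and \<open>\<lfloor>m/d\<rfloor> + \<lfloor>n/d\<rfloor>\<close>, provided each part can be so divided. As \<open>d\<close> grows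
  these intervals follow each other without a gap until the first \<open>d\<close> satisfying (i) or (ii) of the
  definition of \<open>p\<close>.
\<close>

section \<open>Families of sets and of numbers with prescribed sizes\<close>

lemma exists_family_with_cards:
  fixes f :: "nat \<Rightarrow> nat"
  assumes "finite S" and "(\<Sum>i<q. f i) = card S"
  shows "\<exists>A. (\<forall>i<q. card (A i) = f i) \<and> disjoint_family_on A {..<q} \<and> (\<Union>i<q. A i) = S"
  using assms
proof (induction q arbitrary: S)
  case 0
  then show ?case by (auto simp: disjoint_family_on_def)
next
  case (Suc q)
  then obtain B where B: "B \<subseteq> S" "card B = f q" "finite B"
    by (metis le_add2 obtain_subset_with_card_n sum.lessThan_Suc)
  then have "(\<Sum>i<q. f i) = card (S - B)"
    using Suc.prems by (simp add: card_Diff_subset)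
  then obtain A where A: "\<forall>i<q. card (A i) = f i" "disjoint_family_on A {..<q}"
      "(\<Union>i<q. A i) = S - B"
    using Suc.IH Suc.prems(1) by (metis finite_Diff)
  define A' where "A' = A(q := B)"
  have "(\<Union>i<q. A' i) = S - B"
    using A(3) by (auto simp: A'_def)
  then have "(\<Union>i<Suc q. A' i) = S"
    using B(1) by (auto simp: lessThan_Suc A'_def)
  moreover have "disjoint_family_on A' {..<Suc q}"
    unfolding disjoint_family_on_def
  proof (intro ballI impI)
    fix i j assume ij: "i \<in> {..<Suc q}" "j \<in> {..<Suc q}" "i \<noteq> j"
    have sub: "A k \<inter> B = {}" if "k < q" for k
      using A(3) that by blast
    show "A' i \<inter> A' j = {}"
      using ij disjoint_family_onD[OF A(2), of i j] sub[of i] sub[of j]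
      by (auto simp: A'_def less_Suc_eq)
  qed
  moreover have "\<forall>i<Suc q. card (A' i) = f i"
    using A(1) B(2) by (auto simp: A'_def less_Suc_eq)
  ultimately show ?case by blast
qed

text \<open>Greedy filling: the last index takes as much of \<open>m\<close> as its cap
  \<open>h q\<close> admits, and what remains fits under the other caps.\<close>

lemma exists_summand_below:
  fixes h :: "nat \<Rightarrow> nat"
  assumes "m \<le> (\<Sum>i<q. h i)"
  shows "\<exists>f. (\<forall>i. f i \<le> h i) \<and> (\<Sum>i<q. f i) = m"
  using assms
proof (induction q arbitrary: m)
  case 0
  then show ?case by (intro exI[of _ "\<lambda>_. 0"]) auto
next
  case (Suc q)
  have "m - min m (h q) \<le> (\<Sum>i<q. h i)" using Suc.prems by auto
  then obtain f where f: "\<forall>i. f i \<le> h i" "(\<Sum>i<q. f i) = m - min m (h q)"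
    using Suc.IH by blast
  have "(\<Sum>i<q. (f(q := min m (h q))) i) = (\<Sum>i<q. f i)"
    by (intro sum.cong) auto
  then show ?case
    using f by (intro exI[of _ "f(q := min m (h q))"]) auto
qed

text \<open>Every index starts with \<open>s\<close>, and the excess \<open>m - s * a\<close> is
  spread out in units, at most one per index.\<close>

lemma exists_balanced_sizes:
  fixes s a m :: nat
  assumes "s * a \<le> m" and "m \<le> (s + 1) * a"
  shows "\<exists>f. (\<forall>i. f i \<in> {s, s + 1}) \<and> (\<Sum>i<a. f i) = m"
proof -
  have "m - s * a \<le> (\<Sum>i<a. (1::nat))" using assms by simp
  then obtain f :: "nat \<Rightarrow> nat" where f: "\<forall>i. f i \<le> 1" "(\<Sum>i<a. f i) = m - s * a"
    using exists_summand_below by blast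
  show ?thesis
  proof (intro exI[of _ "\<lambda>i. s + f i"] conjI allI)
    fix i show "s + f i \<in> {s, s + 1}" using f(1)[rule_format, of i] by auto
    show "(\<Sum>i<a. s + f i) = m" using f(2) assms(1) by (simp add: sum.distrib mult.commute)
  qed
qed

text \<open>Constructions produce sizes \<open>s\<close> and \<open>s + 1\<close>, which need not be
  the floor and the ceiling if one of them does not occur. A class of size \<open>s\<close> that
  does occur gives \<open>s * q \<le> N < (s + 1) * q\<close>, so \<open>s\<close> is the floor; one
  of size \<open>s + 1\<close> gives \<open>s * q < N \<le> (s + 1) * q\<close>, so
  \<open>s + 1\<close> is the ceiling.\<close>

lemma floor_ceiling_of_near_equal_sizes:
  fixes h :: "nat \<Rightarrow> nat"
  assumes "\<And>i. i < q \<Longrightarrow> h i \<in> {s, s + 1}" and "(\<Sum>i<q. h i) = N" and "i < q"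
  shows "int (h i) \<in> {\<lfloor>real N / real q\<rfloor>, \<lceil>real N / real q\<rceil>}"
proof -
  have q: "q > 0" using assms(3) by auto
  have hi: "h i \<in> {s, s + 1}" using assms(1,3) by blast
  have split: "N = h i + (\<Sum>j\<in>{..<q} - {i}. h j)"
    using assms(2,3) by (metis finite_lessThan lessThan_iff sum.remove)
  have card: "card ({..<q} - {i}) = q - 1" using assms(3) by simp
  have lo: "(q - 1) * s \<le> (\<Sum>j\<in>{..<q} - {i}. h j)"
    using sum_bounded_below[of "{..<q} - {i}" s h] assms(1) card by fastforce
  have hi': "(\<Sum>j\<in>{..<q} - {i}. h j) \<le> (q - 1) * (s + 1)"
    using sum_bounded_above[of "{..<q} - {i}" h "s + 1"] assms(1) card by fastforce
  obtain k where k: "q = Suc k" using q gr0_conv_Suc by auto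
  show ?thesis
  proof (cases "h i = s")
    case True
    have "s * q \<le> N" "N < (s + 1) * q"
      using lo hi' split True k by (auto simp: algebra_simps)
    then have "N div q = s"
      by (intro div_nat_eqI) (auto simp: algebra_simps)
    then have "\<lfloor>real N / real q\<rfloor> = int s"
      by (simp add: floor_divide_of_nat_eq)
    then show ?thesis using True by simp
  next
    case False
    then have eq: "h i = s + 1" using hi by auto
    have "s * q < N" "N \<le> (s + 1) * q"
      using lo hi' split eq k by (auto simp: algebra_simps)
    then have "real s * real q < real N" "real N \<le> (real s + 1) * real q"
      by (metis of_nat_less_iff of_nat_mult, metis of_nat_le_iff of_nat_mult of_nat_Suc Suc_eq_plus1 add.commute)
    then have "\<lceil>real N / real q\<rceil> = int (s + 1)"
      using q by (intro ceiling_unique) (auto simp: field_simps)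
    then show ?thesis using eq by simp
  qed
qed

section \<open>Tree classes of the complete bipartite graph\<close>

lemma verts_complete_bipartite:
  "verts (complete_bipartite m n) = {0} \<times> {..<m} \<union> {1} \<times> {..<n}"
  by (auto simp: complete_multipartite_def Let_def less_Suc_eq)

lemma edges_complete_bipartite:
  "edges (complete_bipartite m n) = {{(0, x), (1, y)} | x y. x < m \<and> y < n}" (is "?L = ?R")
proof
  show "?L \<subseteq> ?R"
  proof
    fix e assume "e \<in> ?L"
    then obtain i x j y where e: "e = {(i, x), (j, y)}" "i < 2" "j < 2" "x < [m, n] ! i"
        "y < [m, n] ! j" "i \<noteq> j"
      by (auto simp: complete_multipartite_def Let_def numeral_2_eq_2)
    then have "i = 0 \<and> j = 1 \<or> i = 1 \<and> j = 0" by auto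
    then show "e \<in> ?R" using e by (auto simp: insert_commute)
  qed
  show "?R \<subseteq> ?L"
    by (fastforce simp: complete_multipartite_def Let_def)
qed

lemma card_verts_complete_bipartite: "card (verts (complete_bipartite m n)) = m + n"
  unfolding verts_complete_bipartite by (subst card_Un_disjoint) auto

text \<open>The first two edges of a cycle on at least three distinct vertices differ, so they
  cannot both be \<open>e\<close>.\<close>

lemma forest_degree_le_1_if_one_edge:
  assumes "edges H \<subseteq> {e}"
  shows "forest H \<and> (\<forall>v\<in>verts H. degree H v \<le> 1)"
proof
  show "forest H"
    unfolding forest_def
  proof
    assume "\<exists>vs. is_cycle H vs"
    then obtain vs where vs: "3 \<le> length vs" "distinct vs"
        "\<And>i. i < length vs \<Longrightarrow> {vs ! i, vs ! ((i + 1) mod length vs)} \<in> edges H"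
      by (auto simp: is_cycle_def)
    have "{vs ! 0, vs ! 1} \<in> edges H" "{vs ! 1, vs ! 2} \<in> edges H"
      using vs(1) vs(3)[of 0] vs(3)[of 1] by (force simp: numeral_2_eq_2)+
    then have "{vs ! 0, vs ! 1} = e" "{vs ! 1, vs ! 2} = e"
      using assms by blast+
    then have "vs ! 0 = vs ! 1 \<or> vs ! 0 = vs ! 2" by (auto simp: doubleton_eq_iff)
    then show False
      using vs(1) nth_eq_iff_index_eq[OF vs(2), of 0 1] nth_eq_iff_index_eq[OF vs(2), of 0 2]
      by linarith
  qed
  show "\<forall>v\<in>verts H. degree H v \<le> 1"
  proof
    fix v
    have "card {e' \<in> edges H. v \<in> e'} \<le> card {e}"
      using assms by (intro card_mono) auto
    then show "degree H v \<le> 1" by (simp add: degree_def)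
  qed
qed

lemma edges_induced_bipartite:
  "edges (induced (complete_bipartite m n) ({0} \<times> B \<union> {1} \<times> C)) =
     {{(0, x), (1, y)} | x y. x \<in> B \<and> x < m \<and> y \<in> C \<and> y < n}"
  unfolding induced_def edges_complete_bipartite by auto

text \<open>A class vertex in one part is joined to all class vertices in the other part, so its
  degree is the number of these.\<close>

lemma tree_class_cards:
  assumes sub: "B \<subseteq> {..<m}" "C \<subseteq> {..<n}"
    and deg: "\<forall>v\<in>verts (induced (complete_bipartite m n) ({0} \<times> B \<union> {1} \<times> C)).
          degree (induced (complete_bipartite m n) ({0} \<times> B \<union> {1} \<times> C)) v \<le> 1"
  shows "card B = 0 \<or> card C = 0 \<or> card B = 1 \<and> card C = 1"
proof -
  let ?H = "induced (complete_bipartite m n) ({0} \<times> B \<union> {1} \<times> C)"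
  have fin: "finite B" "finite C" using sub finite_subset by blast+
  have E: "edges ?H = {{(0, x), (1, y)} | x y. x \<in> B \<and> y \<in> C}"
    unfolding edges_induced_bipartite using sub by auto
  have V: "verts ?H = {0} \<times> B \<union> {1} \<times> C"
    using sub by (auto simp: induced_def verts_complete_bipartite)
  have "card C \<le> 1" if x: "x \<in> B" for x
  proof -
    have "{e \<in> edges ?H. (0, x) \<in> e} = (\<lambda>y. {(0, x), (1, y)}) ` C"
      unfolding E using x by auto
    moreover have "inj_on (\<lambda>y. {(0, x), (1::nat, y)}) C"
      by (auto simp: inj_on_def doubleton_eq_iff)
    ultimately have "degree ?H (0, x) = card C"
      by (simp add: degree_def card_image)
    moreover have "(0, x) \<in> verts ?H" unfolding V using x by blast
    ultimately show ?thesis using deg by metis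
  qed
  moreover have "card B \<le> 1" if y: "y \<in> C" for y
  proof -
    have "{e \<in> edges ?H. (1, y) \<in> e} = (\<lambda>x. {(0, x), (1, y)}) ` B"
      unfolding E using y by auto
    moreover have "inj_on (\<lambda>x. {(0, x), (1::nat, y)}) B"
      by (auto simp: inj_on_def doubleton_eq_iff)
    ultimately have "degree ?H (1, y) = card B"
      by (simp add: degree_def card_image)
    moreover have "(1, y) \<in> verts ?H" unfolding V using y by blast
    ultimately show ?thesis using deg by metis
  qed
  ultimately show ?thesis
    using fin by (cases "B = {} \<or> C = {}") (auto simp: le_Suc_eq)
qed

lemma tree_class_if_cards:
  assumes "B \<subseteq> {..<m}" "C \<subseteq> {..<n}" and "card B = 0 \<or> card C = 0 \<or> card B = 1 \<and> card C = 1"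
  shows "\<exists>e. edges (induced (complete_bipartite m n) ({0} \<times> B \<union> {1} \<times> C)) \<subseteq> {e}"
proof -
  have "finite B" "finite C" using assms(1,2) finite_subset by blast+
  then consider "B = {} \<or> C = {}" | x y where "B = {x}" "C = {y}"
    using assms(3) by (auto simp: card_1_singleton_iff)
  then show ?thesis
    unfolding edges_induced_bipartite by cases auto
qed

section \<open>Translation between colorings and class sizes\<close>

text \<open>Class \<open>i\<close> receives \<open>f i\<close> vertices of the first part and
  \<open>g i\<close> of the second. The two parts are partitioned independently and the pieces glued
  index by index, so that colorings reduce to arithmetic on \<open>f\<close> and
  \<open>g\<close>.\<close>

lemma equitable_partition_from_sizes:
  fixes f g :: "nat \<Rightarrow> nat"
  assumes "(\<Sum>i<q. f i) = m" "(\<Sum>i<q. g i) = n" "\<And>i. i < q \<Longrightarrow> f i + g i \<in> {s, s + 1}"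
  shows "\<exists>B C. equitable_partition q (complete_bipartite m n) (\<lambda>i. {0} \<times> B i \<union> {1} \<times> C i) \<and>
    (\<forall>i<q. B i \<subseteq> {..<m} \<and> C i \<subseteq> {..<n} \<and> card (B i) = f i \<and> card (C i) = g i)"
proof -
  obtain B where B: "\<forall>i<q. card (B i) = f i" "disjoint_family_on B {..<q}" "(\<Union>i<q. B i) = {..<m}"
    using exists_family_with_cards[of "{..<m}" f q] assms(1) by auto
  obtain C where C: "\<forall>i<q. card (C i) = g i" "disjoint_family_on C {..<q}" "(\<Union>i<q. C i) = {..<n}"
    using exists_family_with_cards[of "{..<n}" g q] assms(2) by auto
  let ?A = "\<lambda>i. {0::nat} \<times> B i \<union> {1} \<times> C i"
  have sub: "B i \<subseteq> {..<m} \<and> C i \<subseteq> {..<n}" if "i < q" for i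
    using B(3) C(3) that by blast
  have cardA: "card (?A i) = f i + g i" if "i < q" for i
  proof -
    have "finite (B i)" "finite (C i)" using sub[OF that] finite_subset by blast+
    then show ?thesis
      using that B(1) C(1) by (subst card_Un_disjoint) auto
  qed
  have "(\<Union>i<q. ?A i) = {0} \<times> (\<Union>i<q. B i) \<union> {1} \<times> (\<Union>i<q. C i)"
    by auto
  then have "(\<Union>i<q. ?A i) = verts (complete_bipartite m n)"
    unfolding B(3) C(3) verts_complete_bipartite .
  moreover have "disjoint_family_on ?A {..<q}"
    unfolding disjoint_family_on_def
  proof (intro ballI impI)
    fix i j assume "i \<in> {..<q}" "j \<in> {..<q}" "i \<noteq> j"
    then have "B i \<inter> B j = {}" "C i \<inter> C j = {}"
      using B(2) C(2) by (auto dest: disjoint_family_onD)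
    then show "?A i \<inter> ?A j = {}" by auto
  qed
  moreover have "int (card (?A i)) \<in> {\<lfloor>real (m + n) / real q\<rfloor>, \<lceil>real (m + n) / real q\<rceil>}"
    if "i < q" for i
    unfolding cardA[OF that]
    by (rule floor_ceiling_of_near_equal_sizes[of q "\<lambda>i. f i + g i" s])
      (use assms that in \<open>auto simp: sum.distrib\<close>)
  ultimately have "equitable_partition q (complete_bipartite m n) ?A"
    unfolding equitable_partition_def card_verts_complete_bipartite by blast
  then show ?thesis using sub B(1) C(1) by blast
qed

lemma tree_coloring_from_sizes:
  fixes f g :: "nat \<Rightarrow> nat"
  assumes "(\<Sum>i<q. f i) = m" "(\<Sum>i<q. g i) = n" "\<And>i. i < q \<Longrightarrow> f i + g i \<in> {s, s + 1}"
    and small: "\<And>i. i < q \<Longrightarrow> f i = 0 \<or> g i = 0 \<or> f i = 1 \<and> g i = 1"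
  shows "has_equitable_tree_coloring q 1 (complete_bipartite m n)"
proof -
  obtain B C where BC: "equitable_partition q (complete_bipartite m n) (\<lambda>i. {0} \<times> B i \<union> {1} \<times> C i)"
    "\<forall>i<q. B i \<subseteq> {..<m} \<and> C i \<subseteq> {..<n} \<and> card (B i) = f i \<and> card (C i) = g i"
    using equitable_partition_from_sizes[OF assms(1-3)] by blast
  show ?thesis
    unfolding has_equitable_tree_coloring_def
  proof (intro exI conjI allI impI)
    fix i assume i: "i < q"
    let ?H = "induced (complete_bipartite m n) ({0} \<times> B i \<union> {1} \<times> C i)"
    obtain e where "edges ?H \<subseteq> {e}"
      using tree_class_if_cards[of "B i" m "C i" n] BC(2) i small[OF i] by auto
    from forest_degree_le_1_if_one_edge[OF this]
    show "forest ?H" "\<forall>v\<in>verts ?H. degree ?H v \<le> 1" by blast+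
  qed (rule BC(1))
qed

lemma equitable_coloring_from_sizes:
  fixes f g :: "nat \<Rightarrow> nat"
  assumes "(\<Sum>i<q. f i) = m" "(\<Sum>i<q. g i) = n" "\<And>i. i < q \<Longrightarrow> f i + g i \<in> {s, s + 1}"
    and mono: "\<And>i. i < q \<Longrightarrow> f i = 0 \<or> g i = 0"
  shows "has_equitable_coloring q (complete_bipartite m n)"
proof -
  obtain B C where BC: "equitable_partition q (complete_bipartite m n) (\<lambda>i. {0} \<times> B i \<union> {1} \<times> C i)"
    "\<forall>i<q. B i \<subseteq> {..<m} \<and> C i \<subseteq> {..<n} \<and> card (B i) = f i \<and> card (C i) = g i"
    using equitable_partition_from_sizes[OF assms(1-3)] by blast
  show ?thesis
    unfolding has_equitable_coloring_def
  proof (intro exI conjI allI impI)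
    fix i assume i: "i < q"
    have "finite (B i)" "finite (C i)" using BC(2) i finite_subset by blast+
    then have "B i = {} \<or> C i = {}" using BC(2) i mono[OF i] by auto
    then show "independent (complete_bipartite m n) ({0} \<times> B i \<union> {1} \<times> C i)"
      unfolding independent_def edges_complete_bipartite by auto
  qed (rule BC(1))
qed

text \<open>Converse translation: the traces of the classes on each part partition that part, and
  \<open>tree_class_cards\<close> restricts their sizes.\<close>

lemma sizes_from_tree_coloring:
  assumes "has_equitable_tree_coloring q 1 (complete_bipartite m n)"
  shows "\<exists>f g :: nat \<Rightarrow> nat. (\<Sum>i<q. f i) = m \<and> (\<Sum>i<q. g i) = n \<and>
    (\<forall>i<q. int (f i + g i) \<in> {\<lfloor>real (m + n) / real q\<rfloor>, \<lceil>real (m + n) / real q\<rceil>} \<and>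
       (f i = 0 \<or> g i = 0 \<or> f i = 1 \<and> g i = 1))"
proof -
  let ?G = "complete_bipartite m n"
  obtain A where A: "equitable_partition q ?G A"
    and deg: "\<forall>i<q. \<forall>v \<in> verts (induced ?G (A i)). degree (induced ?G (A i)) v \<le> 1"
    using assms unfolding has_equitable_tree_coloring_def by metis
  then have un: "(\<Union>i<q. A i) = verts ?G" and disj: "disjoint_family_on A {..<q}"
    and size: "\<forall>i<q. int (card (A i)) \<in> {\<lfloor>real (m + n) / real q\<rfloor>, \<lceil>real (m + n) / real q\<rceil>}"
    unfolding equitable_partition_def card_verts_complete_bipartite by simp_all
  define B where "B i = {x. (0, x) \<in> A i}" for i
  define C where "C i = {y. (1, y) \<in> A i}" for i
  have A: "A i = {0} \<times> B i \<union> {1} \<times> C i" if "i < q" for i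
  proof -
    have "A i \<subseteq> {0} \<times> {..<m} \<union> {1} \<times> {..<n}"
      using un that unfolding verts_complete_bipartite by blast
    then have "fst v = 0 \<or> fst v = 1" if "v \<in> A i" for v using that by auto
    then show ?thesis unfolding B_def C_def by fastforce
  qed
  have mem: "v \<in> (\<Union>i<q. A i) \<longleftrightarrow> v \<in> {0} \<times> {..<m} \<union> {1} \<times> {..<n}" for v
    unfolding un verts_complete_bipartite ..
  have UB: "(\<Union>i<q. B i) = {..<m}"
    using mem[of "(0, x)" for x] by (auto simp: B_def)
  have UC: "(\<Union>i<q. C i) = {..<n}"
    using mem[of "(1, y)" for y] by (auto simp: C_def)
  have sub: "B i \<subseteq> {..<m}" "C i \<subseteq> {..<n}" if "i < q" for i
    using UB UC that by blast+
  have fin: "finite (B i)" "finite (C i)" if "i < q" for i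
    using sub[OF that] by (auto intro: finite_subset)
  have dis: "B i \<inter> B j = {}" "C i \<inter> C j = {}" if "i < q" "j < q" "i \<noteq> j" for i j
    using disjoint_family_onD[OF disj, of i j] that by (auto simp: B_def C_def)
  have "card (\<Union>i<q. B i) = (\<Sum>i<q. card (B i))"
    using fin dis by (intro card_UN_disjoint) simp_all
  moreover have "card (\<Union>i<q. C i) = (\<Sum>i<q. card (C i))"
    using fin dis by (intro card_UN_disjoint) simp_all
  moreover have "card (A i) = card (B i) + card (C i)" if "i < q" for i
    unfolding A[OF that] using fin[OF that] by (subst card_Un_disjoint) auto
  moreover have "card (B i) = 0 \<or> card (C i) = 0 \<or> card (B i) = 1 \<and> card (C i) = 1" if "i < q" for i
    using deg[rule_format, OF that] unfolding A[OF that]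
    by (intro tree_class_cards[OF sub[OF that]]) blast
  ultimately show ?thesis
    using UB UC size by (intro exI[of _ "\<lambda>i. card (B i)"] exI[of _ "\<lambda>i. card (C i)"]) auto
qed

section \<open>Equitable colorings as pairs of class counts\<close>

text \<open>
  \<open>splittable m n q\<close> says that \<open>K\<^bsub>m,n\<^esub>\<close> has an equitable \<open>q\<close>-coloring: \<open>a\<close> classes of sizes
  \<open>s\<close>, \<open>s + 1\<close> exhaust the first part and \<open>b\<close> such classes the second.
\<close>
definition splittable :: "nat \<Rightarrow> nat \<Rightarrow> nat \<Rightarrow> bool" where
  "splittable m n q \<longleftrightarrow> (\<exists>s a b. a + b = q \<and> s * a \<le> m \<and> m \<le> (s + 1) * a \<and>
     s * b \<le> n \<and> n \<le> (s + 1) * b)"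

lemma splittableI:
  "\<lbrakk>a + b = q; s * a \<le> m; m \<le> (s + 1) * a; s * b \<le> n; n \<le> (s + 1) * b\<rbrakk> \<Longrightarrow> splittable m n q"
  unfolding splittable_def by blast

text \<open>The first \<open>a\<close> indices serve the first part; the second part uses the
  remaining \<open>b\<close>, shifted by \<open>a\<close>.\<close>

lemma splittable_sizes:
  assumes "splittable m n q"
  shows "\<exists>f g s. (\<Sum>i<q. f i) = m \<and> (\<Sum>i<q. g i) = n \<and>
    (\<forall>i<q. f i + g i \<in> {s, s + 1} \<and> (f i = 0 \<or> g i = 0))"
proof -
  obtain s a b where q: "q = a + b" and m: "s * a \<le> m" "m \<le> (s + 1) * a"
    and n: "s * b \<le> n" "n \<le> (s + 1) * b"
    using assms unfolding splittable_def by blast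
  obtain f where f: "\<forall>i. f i \<in> {s, s + 1}" "(\<Sum>i<a. f i) = m"
    using exists_balanced_sizes[OF m] by blast
  obtain g where g: "\<forall>i. g i \<in> {s, s + 1}" "(\<Sum>i<b. g i) = n"
    using exists_balanced_sizes[OF n] by blast
  have sum: "(\<Sum>i<a + b. if i < a then u i else v (i - a)) = (\<Sum>i<a. u i) + (\<Sum>i<b. v i)"
    for u v :: "nat \<Rightarrow> nat"
    by (induction b) auto
  show ?thesis
    using sum[of f "\<lambda>_. 0"] sum[of "\<lambda>_. 0" g] f g q
    by (intro exI[of _ "\<lambda>i. if i < a then f i else 0"]
        exI[of _ "\<lambda>i. if i < a then 0 else g (i - a)"] exI[of _ s]) auto
qed

lemma equitable_coloring_if_splittable:
  assumes "splittable m n q"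
  shows "has_equitable_coloring q (complete_bipartite m n)"
proof -
  obtain f g s where fg: "(\<Sum>i<q. f i) = m" "(\<Sum>i<q. g i) = n"
      "\<forall>i<q. f i + g i \<in> {s, s + 1} \<and> (f i = 0 \<or> g i = 0)"
    using splittable_sizes[OF assms] by (elim exE conjE)
  show ?thesis
    by (rule equitable_coloring_from_sizes[OF fg(1,2), of s]) (use fg(3) in simp_all)
qed

lemma tree_coloring_if_splittable:
  assumes "splittable m n q"
  shows "has_equitable_tree_coloring q 1 (complete_bipartite m n)"
proof -
  obtain f g s where fg: "(\<Sum>i<q. f i) = m" "(\<Sum>i<q. g i) = n"
      "\<forall>i<q. f i + g i \<in> {s, s + 1} \<and> (f i = 0 \<or> g i = 0)"
    using splittable_sizes[OF assms] by (elim exE conjE)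
  show ?thesis
    by (rule tree_coloring_from_sizes[OF fg(1,2), of s]) (use fg(3) in auto)
qed

text \<open>Classes with at least three vertices cannot be mixed pairs, so each lies inside one
  part; counting the classes of each part gives \<open>a\<close> and \<open>b\<close>.\<close>

lemma splittable_if_tree_coloring:
  assumes "has_equitable_tree_coloring q 1 (complete_bipartite m n)"
    and "3 * q \<le> m + n" and "0 < m"
  shows "splittable m n q"
proof -
  obtain f g :: "nat \<Rightarrow> nat" where f: "(\<Sum>i<q. f i) = m" and g: "(\<Sum>i<q. g i) = n"
    and fg: "\<forall>i<q. int (f i + g i) \<in> {\<lfloor>real (m + n) / real q\<rfloor>, \<lceil>real (m + n) / real q\<rceil>} \<and>
       (f i = 0 \<or> g i = 0 \<or> f i = 1 \<and> g i = 1)"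
    using sizes_from_tree_coloring[OF assms(1)] by (elim exE conjE)
  define s where "s = (m + n) div q"
  have q: "0 < q" using f assms(3) by (cases q) auto
  then have s3: "3 \<le> s"
    using assms(2) by (simp add: s_def less_eq_div_iff_mult_less_eq)
  have fl: "\<lfloor>real (m + n) / real q\<rfloor> = int s"
    unfolding s_def by (simp only: floor_divide_of_nat_eq)
  moreover have "\<lceil>real (m + n) / real q\<rceil> \<in> {int s, int s + 1}"
    using fl by (auto simp del: of_nat_add) linarith
  ultimately have h: "f i + g i \<in> {s, s + 1}" if "i < q" for i
    using fg[rule_format, OF that] by auto
  have one: "f i = 0 \<or> g i = 0" if "i < q" for i
    using fg[rule_format, OF that] h[OF that] s3 by auto
  \<comment> \<open>Every class has at least \<open>s \<ge> 3\<close> vertices in a single part, so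
    \<open>I\<close> indexes the classes inside the first part and \<open>J\<close> those inside the
    second.\<close>
  define I J where "I = {i\<in>{..<q}. g i = 0}" and "J = {i\<in>{..<q}. g i \<noteq> 0}"
  have IJ: "I \<union> J = {..<q}" "I \<inter> J = {}" "finite I" "finite J"
    by (auto simp: I_def J_def)
  have "(\<Sum>i\<in>I. f i) = (\<Sum>i<q. f i)" "(\<Sum>i\<in>J. g i) = (\<Sum>i<q. g i)"
    using one by (force intro!: sum.mono_neutral_left simp: I_def J_def)+
  then have fI: "(\<Sum>i\<in>I. f i) = m" and gJ: "(\<Sum>i\<in>J. g i) = n" using f g by auto
  have fr: "s \<le> f i \<and> f i \<le> s + 1" if "i \<in> I" for i using h[of i] that by (auto simp: I_def)
  have gr: "s \<le> g i \<and> g i \<le> s + 1" if "i \<in> J" for i using h[of i] one[of i] that by (auto simp: J_def)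
  show ?thesis
  proof (rule splittableI)
    show "card I + card J = q"
      using IJ by (metis card_Un_disjoint card_lessThan)
    show "s * card I \<le> m" "m \<le> (s + 1) * card I"
      using sum_bounded_below[of I s f] sum_bounded_above[of I f "s + 1"] fr fI
      by (auto simp: mult.commute)
    show "s * card J \<le> n" "n \<le> (s + 1) * card J"
      using sum_bounded_below[of J s g] sum_bounded_above[of J g "s + 1"] gr gJ
      by (auto simp: mult.commute)
  qed
qed

section \<open>Tree-colorings with classes of at most three vertices\<close>

text \<open>A class of at most two vertices is admissible however it meets the parts, so any
  equitable choice of sizes works.\<close>

lemma tree_coloring_if_many_colors:
  assumes "m + n \<le> 2 * q"
  shows "has_equitable_tree_coloring q 1 (complete_bipartite m n)"
proof -
  define s :: nat where "s = (if m + n \<le> q then 0 else 1)"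
  have s: "s * q \<le> m + n" "m + n \<le> (s + 1) * q" "s \<le> 1"
    using assms by (auto simp: s_def)
  obtain h where h: "\<forall>i. h i \<in> {s, s + 1}" "(\<Sum>i<q. h i) = m + n"
    using exists_balanced_sizes[OF s(1,2)] by blast
  then obtain f where f: "\<forall>i. f i \<le> h i" "(\<Sum>i<q. f i) = m"
    using exists_summand_below[of m h q] by auto
  have "(\<Sum>i<q. h i - f i) = n"
    using f h by (simp add: sum_subtractf_nat)
  moreover have "f i + (h i - f i) \<in> {s, s + 1}" for i
    using f(1) h(1) by simp
  moreover have "f i = 0 \<or> h i - f i = 0 \<or> f i = 1 \<and> h i - f i = 1" for i
    using h(1)[rule_format, of i] s(3) by auto
  ultimately show ?thesis
    by (intro tree_coloring_from_sizes[OF f(2), of "\<lambda>i. h i - f i" n s]) blast+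
qed

lemma tree_coloring_if_enough_triples:
  assumes "m + n \<le> 3 * q" and "m + n \<le> 2 * q + (m div 3 + n div 3)"
  shows "has_equitable_tree_coloring q 1 (complete_bipartite m n)"
proof (cases "m + n \<le> 2 * q")
  case True
  then show ?thesis by (rule tree_coloring_if_many_colors)
next
  case False
  \<comment> \<open>With classes of sizes 2 and 3, \<open>3 * t + 2 * (q - t) = m + n\<close> forces
    \<open>t\<close> triples and \<open>r\<close> pairs.\<close>
  define t where "t = m + n - 2 * q"
  \<comment> \<open>The first part supplies as many triples as it can, and the second part has room
    for the other \<open>j\<close>.\<close>
  define i where "i = min t (m div 3)"
  define j where "j = t - i"
  define r where "r = q - t"
  have t: "m + n = 2 * q + t" "t \<le> m div 3 + n div 3" "q = t + r"
    using False assms by (auto simp: t_def r_def)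
  have ij: "i \<le> m div 3" "j \<le> n div 3" "t = i + j" using t(2) by (auto simp: i_def j_def)
  then have le: "3 * i \<le> m" "3 * j \<le> n" by auto
  have "m - 3 * i \<le> (\<Sum>k<r. 2)" using t le ij(3) by simp
  \<comment> \<open>\<open>f k\<close> counts the first-part vertices in the \<open>k\<close>-th
    pair; the second part fills the pair up with \<open>2 - f k\<close>.\<close>
  then obtain f :: "nat \<Rightarrow> nat" where f: "\<forall>k. f k \<le> 2" "(\<Sum>k<r. f k) = m - 3 * i"
    using exists_summand_below by blast
  have g: "(\<Sum>k<r. 2 - f k) = n - 3 * j"
  proof -
    have "(\<Sum>k<r. 2 - f k) = (\<Sum>k<r. 2) - (\<Sum>k<r. f k)"
      using f(1) by (intro sum_subtractf_nat) auto
    then show ?thesis using f(2) t le ij(3) by simp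
  qed
  \<comment> \<open>The indices are ordered as \<open>i\<close> triples of the first part,
    \<open>j\<close> triples of the second part, then \<open>r\<close> pairs.\<close>
  have split: "(\<Sum>k<i + j + r. if k < i then x else if k < i + j then y else v (k - (i + j)))
      = x * i + y * j + (\<Sum>k<r. v k)" for x y :: nat and v :: "nat \<Rightarrow> nat"
  proof (induction r)
    case 0
    have "(\<Sum>k<i + j. if k < i then x else if k < i + j then y else v (k - (i + j)))
        = (\<Sum>k<i + j. if k < i then x else y)"
      by (intro sum.cong) auto
    also have "\<dots> = x * i + y * j" by (induction j) auto
    finally show ?case by simp
  qed auto
  show ?thesis
  proof (rule tree_coloring_from_sizes)
    show "(\<Sum>k<q. if k < i then 3 else if k < i + j then 0 else f (k - (i + j))) = m"
      using split[of 3 0 f] f(2) le(1) t(3) ij(3) by simp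
    show "(\<Sum>k<q. if k < i then 0 else if k < i + j then 3 else 2 - f (k - (i + j))) = n"
      using split[of 0 3 "\<lambda>k. 2 - f k"] g le(2) t(3) ij(3) by simp
    fix k
    show "(if k < i then 3 else if k < i + j then 0 else f (k - (i + j))) +
        (if k < i then 0 else if k < i + j then 3 else 2 - f (k - (i + j))) \<in> {2, 2 + 1}"
      using f(1) by simp
    show "(if k < i then 3 else if k < i + j then 0 else f (k - (i + j))) = 0 \<or>
        (if k < i then 0 else if k < i + j then 3 else 2 - f (k - (i + j))) = 0 \<or>
        (if k < i then 3 else if k < i + j then 0 else f (k - (i + j))) = 1 \<and>
        (if k < i then 0 else if k < i + j then 3 else 2 - f (k - (i + j))) = 1"
      using f(1)[rule_format, of "k - (i + j)"] by auto
  qed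
qed

text \<open>One failure suffices for minimality: any bound \<open>p' < p\<close> would promise a
  coloring with \<open>p - 1\<close> colors. Positivity of \<open>p\<close> keeps
  \<open>p - 1\<close> strictly below \<open>p\<close>.\<close>

lemma strong_equitable_arboricity_eqI:
  assumes "\<And>q. p \<le> q \<Longrightarrow> has_equitable_tree_coloring q r G"
    and "0 < p" and "\<not> has_equitable_tree_coloring (p - 1) r G"
  shows "strong_equitable_arboricity r G = p"
  unfolding strong_equitable_arboricity_def
proof (rule Least_equality)
  fix p' assume p': "\<forall>q\<ge>p'. has_equitable_tree_coloring q r G"
  show "p \<le> p'"
  proof (rule ccontr)
    assume "\<not> p \<le> p'"
    then have "p' \<le> p - 1" by simp
    then show False using p' assms(3) by blast
  qed
qed (use assms(1) in blast)

section \<open>Ceiling division and the condition defining \<open>p\<close>\<close>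

definition ceil_div :: "nat \<Rightarrow> nat \<Rightarrow> nat" where
  "ceil_div n d = nat \<lceil>real n / real d\<rceil>"

text \<open>Thus \<open>ceil_div n d\<close> is the least number of classes of size at most
  \<open>d\<close> that can exhaust \<open>n\<close> vertices.\<close>

lemma ceil_div_le_iff:
  assumes "0 < d"
  shows "ceil_div n d \<le> a \<longleftrightarrow> n \<le> d * a"
proof -
  have "ceil_div n d \<le> a \<longleftrightarrow> \<lceil>real n / real d\<rceil> \<le> int a"
    by (simp add: ceil_div_def nat_le_iff)
  also have "\<dots> \<longleftrightarrow> real n \<le> real d * real a"
    using assms by (simp add: ceiling_le_iff field_simps)
  also have "\<dots> \<longleftrightarrow> n \<le> d * a"
    by (metis of_nat_le_iff of_nat_mult)
  finally show ?thesis .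
qed

lemma ceil_div_eq:
  assumes "0 < d"
  shows "ceil_div n d = (if d dvd n then n div d else n div d + 1)"
proof (cases "d dvd n")
  case True
  then show ?thesis
    using assms by (auto simp: ceil_div_def elim!: dvdE)
next
  case False
  then have "0 < n mod d" by (simp add: mod_greater_zero_iff_not_dvd)
  then have "\<not> n \<le> d * (n div d)"
    by (metis add_le_same_cancel1 mult_div_mod_eq not_le)
  moreover have "n \<le> d * (n div d + 1)"
    using assms by (simp add: dividend_less_times_div less_imp_le)
  ultimately show ?thesis
    using False ceil_div_le_iff[OF assms, of n] by (metis Suc_eq_plus1 le_antisym not_less_eq_eq)
qed

lemma ceil_div_Suc_le:
  assumes "0 < d"
  shows "ceil_div k (Suc d) \<le> ceil_div k d"
proof -
  have "k \<le> d * ceil_div k d" using ceil_div_le_iff[OF assms] by blast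
  then have "k \<le> Suc d * ceil_div k d" by simp
  then show ?thesis using ceil_div_le_iff[of "Suc d"] by blast
qed

text \<open>Clearing the denominator in (ii) also absorbs the separate case \<open>k < d\<close>,
  where \<open>k div d = 0\<close>. The inequality \<open>(d + 1) * (k div d) < k\<close> says that
  \<open>k\<close> vertices cannot be cut into classes of sizes \<open>d\<close> and
  \<open>d + 1\<close>: at most \<open>k div d\<close> such classes fit, and they cover too
  little.\<close>

lemma p_cond_pair_iff:
  assumes "0 < d" "0 < m" "0 < n"
  shows "p_cond [m, n] d \<longleftrightarrow> (\<not> d dvd m \<and> \<not> d dvd n) \<or>
    (d + 1) * (m div d) < m \<or> (d + 1) * (n div d) < n"
proof -
  have *: "(0 < k \<and> k < d) \<or> real k / real_of_int \<lfloor>real k / real d\<rfloor> > real d + 1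
      \<longleftrightarrow> (d + 1) * (k div d) < k" if "0 < k" for k
  proof (cases "k < d")
    case False
    then have pos: "0 < k div d" using assms(1) by (simp add: div_greater_zero_iff)
    have "real k / real_of_int \<lfloor>real k / real d\<rfloor> > real d + 1 \<longleftrightarrow> (real d + 1) * real (k div d) < real k"
      unfolding floor_divide_of_nat_eq using pos by (simp add: pos_less_divide_eq)
    also have "\<dots> \<longleftrightarrow> real ((d + 1) * (k div d)) < real k"
      by (simp add: algebra_simps)
    also have "\<dots> \<longleftrightarrow> (d + 1) * (k div d) < k" by (rule of_nat_less_iff)
    finally show ?thesis using False by simp
  qed (use that in simp)
  define Q where "Q k \<longleftrightarrow> (0 < k \<and> k < d) \<or> real k / real_of_int \<lfloor>real k / real d\<rfloor> > real d + 1" for k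
  have "p_cond [m, n] d \<longleftrightarrow>
      (\<exists>i j. i < 2 \<and> j < 2 \<and> i \<noteq> j \<and> \<not> d dvd [m, n] ! i \<and> \<not> d dvd [m, n] ! j) \<or>
      (\<exists>i<2. Q ([m, n] ! i))"
    unfolding p_cond_def Q_def by (simp add: numeral_2_eq_2)
  moreover have "(\<exists>i<2. Q ([m, n] ! i)) \<longleftrightarrow> Q m \<or> Q n"
    by (auto simp: less_Suc_eq numeral_2_eq_2)
  moreover have "(\<exists>i j. i < 2 \<and> j < 2 \<and> i \<noteq> j \<and> \<not> d dvd [m, n] ! i \<and> \<not> d dvd [m, n] ! j)
      \<longleftrightarrow> \<not> d dvd m \<and> \<not> d dvd n" (is "?L \<longleftrightarrow> ?R")
  proof
    show "?L \<Longrightarrow> ?R" by (auto simp: less_Suc_eq numeral_2_eq_2)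
    show "?R \<Longrightarrow> ?L" by (intro exI[of _ 0] exI[of _ 1]) simp
  qed
  moreover have "Q m \<longleftrightarrow> (d + 1) * (m div d) < m" "Q n \<longleftrightarrow> (d + 1) * (n div d) < n"
    unfolding Q_def using * assms(2,3) by blast+
  ultimately show ?thesis by simp
qed

section \<open>Runs of splittable numbers of colors\<close>

text \<open>A part of size \<open>k\<close> can be cut into \<open>x\<close> classes of sizes
  \<open>d\<close>, \<open>d + 1\<close> iff
  \<open>ceil_div k (d + 1) \<le> x \<le> k div d\<close>. Both intervals are nonempty here, and
  their sumset is again an interval.\<close>

lemma splittable_between_ceil_floor:
  assumes "0 < d" and "(d + 1) * (m div d) \<ge> m" "(d + 1) * (n div d) \<ge> n"
    and "ceil_div m (d + 1) + ceil_div n (d + 1) \<le> q" "q \<le> m div d + n div d"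
  shows "splittable m n q"
proof -
  have c: "ceil_div m (d + 1) \<le> m div d" "ceil_div n (d + 1) \<le> n div d"
    using assms(2,3) by (simp_all add: ceil_div_le_iff)
  \<comment> \<open>The first part gets as many classes as possible while the second keeps its
    minimum.\<close>
  define a where "a = min (m div d) (q - ceil_div n (d + 1))"
  have a: "a \<le> m div d" "ceil_div m (d + 1) \<le> a" "ceil_div n (d + 1) \<le> q - a" "q - a \<le> n div d" "a \<le> q"
    using assms(4,5) c by (auto simp: a_def)
  have low: "d * x \<le> k" if "x \<le> k div d" for x k
    using that by (metis div_times_less_eq_dividend le_trans mult.commute mult_le_mono1)
  show ?thesis
  proof (rule splittableI)
    show "a + (q - a) = q" using a by simp
    show "d * a \<le> m" "d * (q - a) \<le> n" using a low by blast+
    show "m \<le> (d + 1) * a" "n \<le> (d + 1) * (q - a)"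
      using a(2,3) ceil_div_le_iff[of "d + 1"] by auto
  qed
qed

text \<open>
  Fewer colors than \<open>\<lceil>m/d\<rceil> + \<lceil>n/d\<rceil>\<close> force all classes to have size at least \<open>d\<close>, and
  \<open>p_cond\<close> is exactly the obstruction to doing this with one color less.
\<close>
lemma not_splittable_below_p:
  assumes "0 < d" "0 < m" "0 < n" "p_cond [m, n] d"
  shows "\<not> splittable m n (ceil_div m d + ceil_div n d - 1)"
proof
  assume "splittable m n (ceil_div m d + ceil_div n d - 1)"
  then obtain s a b where ab: "a + b = ceil_div m d + ceil_div n d - 1"
    and m: "s * a \<le> m" "m \<le> (s + 1) * a" and n: "s * b \<le> n" "n \<le> (s + 1) * b"
    unfolding splittable_def by blast
  have pos: "0 < a" "0 < b" using m n assms(2,3) by (auto intro!: Nat.gr0I)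
  then have "\<not> ceil_div m d \<le> a \<or> \<not> ceil_div n d \<le> b" using ab by linarith
  then have "d * a < (s + 1) * a \<or> d * b < (s + 1) * b"
    using ceil_div_le_iff[OF assms(1)] m(2) n(2) by (meson le_less_trans not_le order_less_le_trans)
  then have "d < s + 1" using mult_less_cancel2 by blast
  then have sd: "d \<le> s" by simp
  have le: "a \<le> m div d" "b \<le> n div d"
    using m(1) n(1) sd assms(1)
    by (metis div_le_mono div_mult_self1_is_m le_trans mult_le_mono1)+
  \<comment> \<open>If \<open>d\<close> divided neither part, both ceilings would exceed the floors
    and \<open>a + b\<close> would be \<open>m div d + n div d + 1\<close>, too large for
    \<open>le\<close>.\<close>
  have dvd: "d dvd m \<or> d dvd n"
    using ab le ceil_div_eq[OF assms(1)] pos by (auto split: if_splits)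
  \<comment> \<open>\<open>k\<close> is the part violating (ii) and \<open>l\<close> the one
    divisible by \<open>d\<close>. Both counts must be maximal; covering \<open>k\<close> then
    forces \<open>d < s\<close>, while \<open>l = d * b'\<close> leaves no room for classes larger
    than \<open>d\<close>.\<close>
  have contra: False
    if kl: "(d + 1) * (k div d) < k" "d dvd l" "a' \<le> k div d" "b' \<le> l div d" "0 < b'"
      "k \<le> (s + 1) * a'" "s * b' \<le> l" "a' + b' = ceil_div k d + ceil_div l d - 1" for k l a' b'
  proof -
    have "\<not> d dvd k" using kl(1) by auto
    then have eq: "a' = k div d" "b' = l div d"
      using kl ceil_div_eq[OF assms(1)] by auto
    have "(d + 1) * a' < (s + 1) * a'" using kl(1,6)[folded eq(1)] order_less_le_trans by blast
    then have "d < s" by simp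
    then have "d * b' < s * b'" using kl(5) by simp
    then show False using kl(2,7) eq by simp
  qed
  have nd: "d dvd k \<Longrightarrow> \<not> (d + 1) * (k div d) < k" for k by auto
  from assms(4) consider "(d + 1) * (m div d) < m" | "(d + 1) * (n div d) < n"
    using p_cond_pair_iff[OF assms(1-3)] dvd by blast
  then show False
  proof cases
    case 1
    then have "d dvd n" using nd dvd by blast
    then show False using contra[OF 1 _ le pos(2) m(2) n(1) ab] by simp
  next
    case 2
    then have "d dvd m" using nd dvd by blast
    then show False using contra[OF 2 _ le(2,1) pos(1) n(2) m(1)] ab by (simp add: add.commute)
  qed
qed

text \<open>For this \<open>d\<close> the given classes can be taken of sizes \<open>d - 1\<close>
  and \<open>d\<close>. Using fewer classes preserves the lower size bound, and the upper one
  survives down to the ceilings.\<close>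

lemma splittable_down_to_ceil:
  assumes "splittable m n q" "0 < q" "0 < m" "0 < n" and d: "int d = \<lceil>real (m + n) / real q\<rceil>"
  shows "ceil_div m d + ceil_div n d \<le> q"
    and "\<And>q'. \<lbrakk>ceil_div m d + ceil_div n d \<le> q'; q' \<le> q\<rbrakk> \<Longrightarrow> splittable m n q'"
proof -
  obtain s a b where q: "a + b = q" and m: "s * a \<le> m" "m \<le> (s + 1) * a"
    and n: "s * b \<le> n" "n \<le> (s + 1) * b"
    using assms(1) unfolding splittable_def by blast
  have dge: "m + n \<le> d * q"
  proof -
    have "real (m + n) / real q \<le> real d" using d by linarith
    then have "real (m + n) \<le> real (d * q)" using assms(2) by (simp add: field_simps)
    then show ?thesis by linarith
  qed
  have dlt: "(d - 1) * q < m + n" and d0: "0 < d"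
  proof -
    show d0: "0 < d" using dge assms(3) by (cases d) auto
    have "real d - 1 < real (m + n) / real q" using d by linarith
    then have "real ((d - 1) * q) < real (m + n)"
      using assms(2) d0 by (simp add: field_simps of_nat_diff)
    then show "(d - 1) * q < m + n" by linarith
  qed
  have "s * q \<le> m + n" "m + n \<le> (s + 1) * q"
    using m n q by (auto simp: algebra_simps)
  then have "s * q \<le> d * q" "(d - 1) * q < (s + 1) * q" using dge dlt by linarith+
  then have "s \<le> d" "d - 1 < s + 1" using assms(2) mult_le_cancel2 mult_less_cancel2 by blast+
  \<comment> \<open>The case \<open>d = s\<close> arises only when \<open>q\<close> divides
    \<open>m + n\<close> and all classes have size exactly \<open>s\<close>.\<close>
  then consider "d = s + 1" | "d = s" using d0 by linarith
  then have e: "(d - 1) * a \<le> m \<and> m \<le> d * a \<and> (d - 1) * b \<le> n \<and> n \<le> d * b"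
  proof cases
    case 1
    then show ?thesis using m n by simp
  next
    case 2
    then have "s * a + s * b = m + n"
      using dge m n unfolding q[symmetric] by (simp add: add_mult_distrib2)
    then have "m = d * a" "n = d * b" using m n 2 by auto
    then show ?thesis by simp
  qed
  then have c: "ceil_div m d \<le> a" "ceil_div n d \<le> b" using ceil_div_le_iff[OF d0] by auto
  then show "ceil_div m d + ceil_div n d \<le> q" using q by simp
  fix q' assume q': "ceil_div m d + ceil_div n d \<le> q'" "q' \<le> q"
  define a' where "a' = min a (q' - ceil_div n d)"
  have a': "a' \<le> a" "ceil_div m d \<le> a'" "ceil_div n d \<le> q' - a'" "q' - a' \<le> b" "a' \<le> q'"
    using q' q c by (auto simp: a'_def)
  show "splittable m n q'"
  proof (rule splittableI)
    show "a' + (q' - a') = q'" using a' by simp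
    show "(d - 1) * a' \<le> m" "(d - 1) * (q' - a') \<le> n"
      using a' e by (meson le_trans mult_le_mono2)+
    show "m \<le> (d - 1 + 1) * a'" "n \<le> (d - 1 + 1) * (q' - a')"
      using a'(2,3) ceil_div_le_iff[OF d0] d0 by auto
  qed
qed

text \<open>\<open>p_num q [m, n]\<close> is the left end of the run of consecutive splittable
  numbers containing \<open>q\<close>. The run is extended downwards by induction on
  \<open>d\<close>, from the ceiling of \<open>(m + n) / q\<close> to the minimal \<open>d\<close>
  satisfying \<open>p_cond\<close>.\<close>

lemma p_num_characterization:
  assumes "splittable m n q" "0 < m" "0 < n"
  shows "0 < p_num q [m, n]" and "p_num q [m, n] \<le> q"
    and "\<And>q'. \<lbrakk>p_num q [m, n] \<le> q'; q' \<le> q\<rbrakk> \<Longrightarrow> splittable m n q'"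
    and "\<not> splittable m n (p_num q [m, n] - 1)"
proof -
  have q0: "0 < q"
    using assms(1,2) by (auto simp: splittable_def intro!: Nat.gr0I)
  define d0 where "d0 = nat \<lceil>real (m + n) / real q\<rceil>"
  have d0: "int d0 = \<lceil>real (m + n) / real q\<rceil>"
    using ceiling_mono[of 0 "real (m + n) / real q"] by (simp add: d0_def)
  have d0pos: "0 < d0" using d0 q0 assms(2)
    by (metis add_pos_pos assms(3) bot_nat_0.not_eq_extremum divide_pos_pos not_less of_int_0
        ceiling_le_iff of_nat_0 of_nat_0_less_iff order_refl)
  define D where "D = p_min q [m, n]"
  define P where "P d \<longleftrightarrow> d0 \<le> d \<and> p_cond [m, n] d" for d
  have D: "D = (LEAST d. P d)"
    unfolding D_def p_min_def P_def using d0 by (simp del: of_nat_add add: d0[symmetric])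
  \<comment> \<open>Any \<open>d > m\<close> satisfies (ii), as then \<open>m div d = 0\<close>;
    hence the least \<open>d\<close> exists.\<close>
  have "P (d0 + m)"
    using d0pos assms(2,3) by (simp add: P_def p_cond_pair_iff)
  then have PD: "P D" unfolding D by (rule LeastI)
  have min: "\<not> P d" if "d < D" for d
    using that unfolding D by (rule not_less_Least)
  let ?c = "\<lambda>d. ceil_div m d + ceil_div n d"
  have p: "p_num q [m, n] = ?c D"
    using equitable_coloring_if_splittable[OF assms(1)]
    by (simp add: p_num_def ceil_div_def D_def numeral_2_eq_2)
  have Dpos: "0 < D" using PD d0pos by (simp add: P_def)
  have all: "?c d \<le> q \<and> (\<forall>q'. ?c d \<le> q' \<and> q' \<le> q \<longrightarrow> splittable m n q')" if "d0 \<le> d" "d \<le> D" for d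
    using that
  proof (induction d rule: dec_induct)
    case base
    then show ?case using splittable_down_to_ceil[OF assms(1) q0 assms(2,3) d0] by blast
  next
    case (step d)
    have dpos: "0 < d" using d0pos step by simp
    have "\<not> p_cond [m, n] d" using min[of d] step by (simp add: P_def)
    then have nc: "d dvd m \<or> d dvd n" "m \<le> (d + 1) * (m div d)" "n \<le> (d + 1) * (n div d)"
      using p_cond_pair_iff[OF dpos assms(2,3)] by auto
    \<comment> \<open>One part is divisible by \<open>d\<close>, so the ceilings exceed the floors
      by at most one in total: no gap opens between the interval for \<open>d\<close> and the
      numbers from \<open>?c d\<close> on.\<close>
    then have fl: "?c d \<le> m div d + n div d + 1" using ceil_div_eq[OF dpos] by auto
    have "?c (Suc d) \<le> ?c d"
      using ceil_div_Suc_le[OF dpos] by (intro add_mono)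
    moreover have IH: "?c d \<le> q" "\<And>q'. \<lbrakk>?c d \<le> q'; q' \<le> q\<rbrakk> \<Longrightarrow> splittable m n q'"
      using step by auto
    moreover have "splittable m n q'" if "?c (Suc d) \<le> q'" "q' \<le> q" for q'
    proof (cases "?c d \<le> q'")
      case True
      then show ?thesis using IH(2) that(2) by blast
    next
      case False
      then have "q' \<le> m div d + n div d" using fl by linarith
      then show ?thesis
        using splittable_between_ceil_floor[OF dpos nc(2,3)] that(1) by simp
    qed
    ultimately show ?case by (meson le_trans)
  qed
  have "0 < ceil_div m D"
    using ceil_div_le_iff[OF Dpos, of m 0] assms(2) by auto
  then show "0 < p_num q [m, n]" using p by simp
  show "p_num q [m, n] \<le> q" "\<And>q'. \<lbrakk>p_num q [m, n] \<le> q'; q' \<le> q\<rbrakk> \<Longrightarrow> splittable m n q'"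
    using all[of D] PD p by (auto simp: P_def)
  show "\<not> splittable m n (p_num q [m, n] - 1)"
    using not_splittable_below_p[OF Dpos assms(2,3)] PD p by (simp add: P_def)
qed

section \<open>Values of the arboricity\<close>

text \<open>Up to \<open>q\<close> colors the run of splittable numbers provides the colorings,
  beyond \<open>q\<close> triples and pairs do. One color below the run, all classes still have at
  least three vertices, so a tree-coloring would be a splitting.\<close>

lemma arboricity_eq_p_num:
  assumes "splittable m n q" "0 < m" "0 < n" "3 * (q - 1) \<le> m + n" "m + n \<le> 3 * (q + 1)"
    and "m + n \<le> 2 * (q + 1) + (m div 3 + n div 3)"
  shows "strong_equitable_arboricity 1 (complete_bipartite m n) = p_num q [m, n]"
proof (rule strong_equitable_arboricity_eqI)
  note p = p_num_characterization[OF assms(1-3)]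
  fix q' assume "p_num q [m, n] \<le> q'"
  then show "has_equitable_tree_coloring q' 1 (complete_bipartite m n)"
  proof (cases "q' \<le> q")
    case True
    then show ?thesis
      using \<open>p_num q [m, n] \<le> q'\<close> p(3) tree_coloring_if_splittable by blast
  next
    case False
    then have "3 * (q + 1) \<le> 3 * q'" "2 * (q + 1) \<le> 2 * q'" by simp_all
    then show ?thesis
      using assms(5,6) add_right_mono le_trans by (intro tree_coloring_if_enough_triples) blast+
  qed
next
  note p = p_num_characterization[OF assms(1-3)]
  show "0 < p_num q [m, n]" by (rule p(1))
  show "\<not> has_equitable_tree_coloring (p_num q [m, n] - 1) 1 (complete_bipartite m n)"
    using splittable_if_tree_coloring[of "p_num q [m, n] - 1" m n] p(2,4) assms(2,4) by fastforce
qed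

lemma arboricity_eq_if_not_splittable:
  assumes "\<not> splittable m n (p - 1)" "0 < m" "0 < p" "3 * (p - 1) \<le> m + n" "m + n \<le> 3 * p"
    and "m + n \<le> 2 * p + (m div 3 + n div 3)"
  shows "strong_equitable_arboricity 1 (complete_bipartite m n) = p"
  using assms splittable_if_tree_coloring[of "p - 1" m n]
  by (intro strong_equitable_arboricity_eqI tree_coloring_if_enough_triples) auto

text \<open>A class in the small part forces \<open>s \<le> 2\<close>, so the second part has
  \<open>n \<le> 3 * b\<close>; then \<open>3 * q \<le> m + n\<close> leaves
  \<open>3 * a \<le> m < 3\<close>.\<close>

lemma not_splittable_small_part:
  assumes "0 < m" "m \<le> 2" "0 < n" "3 * q \<le> m + n"
  shows "\<not> splittable m n q"
proof
  assume "splittable m n q"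
  then obtain s a b where q: "a + b = q" and m: "s * a \<le> m" "m \<le> (s + 1) * a"
    and n: "s * b \<le> n" "n \<le> (s + 1) * b"
    unfolding splittable_def by blast
  have a: "0 < a" using m assms(1) by (auto intro!: Nat.gr0I)
  have b: "0 < b" using n assms(3) by (auto intro!: Nat.gr0I)
  have "s * 1 \<le> s * a" using a by (intro mult_le_mono2) simp
  then have "s \<le> 2" using m(1) assms(2) by linarith
  then have "(s + 1) * b \<le> 3 * b" by (intro mult_le_mono1) simp
  then have "3 * a \<le> m" using assms(4) n q by linarith
  then show False using a assms(2) by simp
qed

text \<open>If \<open>s = 2\<close>, classes have at most three vertices and
  \<open>3 * q \<le> m + n\<close> makes them all exact triples; otherwise \<open>s \<ge> 3\<close>
  directly.\<close>

lemma splittable_class_size: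
  assumes "splittable m n q" "3 * q \<le> m + n" "m + n < 4 * q"
  shows "\<exists>a b. a + b = q \<and> 3 * a \<le> m \<and> 3 * b \<le> n"
proof -
  obtain s a b where q: "a + b = q" and m: "s * a \<le> m" "m \<le> (s + 1) * a"
    and n: "s * b \<le> n" "n \<le> (s + 1) * b"
    using assms(1) unfolding splittable_def by blast
  have "m + n \<le> (s + 1) * q" using m n q by (auto simp: algebra_simps)
  then have "3 * q \<le> (s + 1) * q" using assms(2) by linarith
  then have s: "2 \<le> s" using assms(2,3) by auto
  show ?thesis
  proof (cases "s = 2")
    case True
    then show ?thesis using m n q assms(2) by (intro exI[of _ a] exI[of _ b]) auto
  next
    case False
    then have "3 \<le> s" using s by simp
    then have "3 * a \<le> s * a" "3 * b \<le> s * b" by (rule mult_le_mono1)+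
    then show ?thesis using m n q le_trans by blast
  qed
qed

theorem theorem2:
  fixes m n :: nat
  assumes "0 < m" and "0 < n"
  shows
    "(m = 1 \<longrightarrow>
        int (strong_equitable_arboricity 1 (complete_bipartite m n)) = \<lceil>(real n + 2) / 3\<rceil>) \<and>
     (m = 2 \<longrightarrow>
        int (strong_equitable_arboricity 1 (complete_bipartite m n)) = \<lceil>(real n + 3) / 3\<rceil>) \<and>
     (\<forall>b c :: nat. 0 < b \<and> 0 < c \<longrightarrow>
        (m = 3 * b \<and> n = 3 * c \<longrightarrow>
           strong_equitable_arboricity 1 (complete_bipartite m n) = p_num (b + c) [m, n]) \<and>
        (m = 3 * b \<and> n = 3 * c + 1 \<longrightarrow>
           strong_equitable_arboricity 1 (complete_bipartite m n) = p_num (b + c) [m, n]) \<and>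
        (m = 3 * b \<and> n = 3 * c + 2 \<longrightarrow>
           strong_equitable_arboricity 1 (complete_bipartite m n) = p_num (b + c + 1) [m, n]) \<and>
        (m = 3 * b + 1 \<and> n = 3 * c + 1 \<longrightarrow>
           strong_equitable_arboricity 1 (complete_bipartite m n) = p_num (b + c) [m, n]) \<and>
        (m = 3 * b + 1 \<and> n = 3 * c + 2 \<longrightarrow>
           strong_equitable_arboricity 1 (complete_bipartite m n) = b + c + 2) \<and>
        (m = 3 * b + 2 \<and> n = 3 * c + 2 \<longrightarrow>
           strong_equitable_arboricity 1 (complete_bipartite m n) = b + c + 2))"
proof (intro conjI allI impI)
  have part: "strong_equitable_arboricity 1 (complete_bipartite m n) = p"
    if "m \<le> 2" "0 < p" "3 * (p - 1) \<le> m + n" "m + n \<le> 3 * p" "m + n \<le> 2 * p + (m div 3 + n div 3)"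
    for p
    using that assms not_splittable_small_part[of m n "p - 1"]
    by (intro arboricity_eq_if_not_splittable) auto
  {
    assume m: "m = 1"
    \<comment> \<open>\<open>(n + 4) div 3\<close> is the ceiling of \<open>(n + 2) / 3\<close> in
      natural-number form.\<close>
    have "strong_equitable_arboricity 1 (complete_bipartite m n) = (n + 4) div 3"
      using m by (intro part) presburger+
    moreover have "\<lceil>(real n + 2) / 3\<rceil> = int ((n + 4) div 3)"
    proof (rule ceiling_unique)
      have "n + 2 \<le> 3 * ((n + 4) div 3)" "3 * ((n + 4) div 3) \<le> n + 4" by presburger+
      then have "real n + 2 \<le> 3 * real ((n + 4) div 3)" "3 * real ((n + 4) div 3) \<le> real n + 4"
        by linarith+
      then show "real_of_int (int ((n + 4) div 3)) - 1 < (real n + 2) / 3"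
          "(real n + 2) / 3 \<le> real_of_int (int ((n + 4) div 3))"
        by (simp_all add: field_simps)
    qed
    ultimately show "int (strong_equitable_arboricity 1 (complete_bipartite m n)) = \<lceil>(real n + 2) / 3\<rceil>"
      by simp
  next
    assume m: "m = 2"
    have "strong_equitable_arboricity 1 (complete_bipartite m n) = (n + 5) div 3"
      using m by (intro part) presburger+
    moreover have "\<lceil>(real n + 3) / 3\<rceil> = int ((n + 5) div 3)"
    proof (rule ceiling_unique)
      have "n + 3 \<le> 3 * ((n + 5) div 3)" "3 * ((n + 5) div 3) \<le> n + 5" by presburger+
      then have "real n + 3 \<le> 3 * real ((n + 5) div 3)" "3 * real ((n + 5) div 3) \<le> real n + 5"
        by linarith+
      then show "real_of_int (int ((n + 5) div 3)) - 1 < (real n + 3) / 3"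
          "(real n + 3) / 3 \<le> real_of_int (int ((n + 5) div 3))"
        by (simp_all add: field_simps)
    qed
    ultimately show "int (strong_equitable_arboricity 1 (complete_bipartite m n)) = \<lceil>(real n + 3) / 3\<rceil>"
      by simp
  }
  fix b c :: nat assume bc: "0 < b \<and> 0 < c"
  {
    assume mn: "m = 3 * b \<and> n = 3 * c"
    then have "splittable m n (b + c)"
      using bc by (intro splittableI[of b c _ 3]) auto
    then show "strong_equitable_arboricity 1 (complete_bipartite m n) = p_num (b + c) [m, n]"
      using mn assms by (intro arboricity_eq_p_num) auto
  next
    assume mn: "m = 3 * b \<and> n = 3 * c + 1"
    then have "splittable m n (b + c)"
      using bc by (intro splittableI[of b c _ 3]) auto
    then show "strong_equitable_arboricity 1 (complete_bipartite m n) = p_num (b + c) [m, n]"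
      using mn assms by (intro arboricity_eq_p_num) auto
  next
    assume mn: "m = 3 * b \<and> n = 3 * c + 2"
    \<comment> \<open>Here the sizes are 2 and 3: the second part consists of \<open>c\<close>
      triples and one pair.\<close>
    then have "splittable m n (b + c + 1)"
      using bc by (intro splittableI[of b "c + 1" _ 2]) auto
    then show "strong_equitable_arboricity 1 (complete_bipartite m n) = p_num (b + c + 1) [m, n]"
      using mn assms by (intro arboricity_eq_p_num) auto
  next
    assume mn: "m = 3 * b + 1 \<and> n = 3 * c + 1"
    then have "splittable m n (b + c)"
      using bc by (intro splittableI[of b c _ 3]) auto
    \<comment> \<open>With \<open>b + c + 1\<close> colors the two vertices left over by the
      \<open>b + c\<close> triples form a mixed pair.\<close>
    then show "strong_equitable_arboricity 1 (complete_bipartite m n) = p_num (b + c) [m, n]"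
      using mn assms by (intro arboricity_eq_p_num) auto
  next
    assume mn: "m = 3 * b + 1 \<and> n = 3 * c + 2"
    \<comment> \<open>The parts contain only \<open>b\<close> and \<open>c\<close> disjoint triples,
      one fewer than the number of classes.\<close>
    have "\<not> splittable m n (b + c + 1)"
    proof
      assume "splittable m n (b + c + 1)"
      from splittable_class_size[OF this] mn obtain x y where
        xy: "x + y = b + c + 1" "3 * x \<le> m" "3 * y \<le> n" by auto
      then have "x \<le> b" "y \<le> c" using mn by simp_all
      then show False using xy(1) by simp
    qed
    then show "strong_equitable_arboricity 1 (complete_bipartite m n) = b + c + 2"
      using mn assms by (intro arboricity_eq_if_not_splittable) auto
  next
    assume mn: "m = 3 * b + 2 \<and> n = 3 * c + 2"
    have "\<not> splittable m n (b + c + 1)"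
    proof
      assume "splittable m n (b + c + 1)"
      from splittable_class_size[OF this] mn bc obtain x y where
        xy: "x + y = b + c + 1" "3 * x \<le> m" "3 * y \<le> n" by auto
      then have "x \<le> b" "y \<le> c" using mn by simp_all
      then show False using xy(1) by simp
    qed
    \<comment> \<open>The bound on triples is tight here: \<open>b + c\<close> triples and two pairs
      make up all vertices.\<close>
    then show "strong_equitable_arboricity 1 (complete_bipartite m n) = b + c + 2"
      using mn assms by (intro arboricity_eq_if_not_splittable) auto
  }
qed

end
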